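(* Let $1<p<q<\infty$ and let $(Y,d_Y)$ be a rounded ball metric space with power type $p$. There is a constant $\alpha>0$ depending only on $p,q,Y$ such that for every $D\ge1$ there exists $\varepsilon=\varepsilon(D,p,q,Y)>0$ with the following property: for every $k\in\mathbb{N}$ and every metric space $(X,d_X)$, if $X$ admits an $(\varepsilon,q)$-thin $k$-Laakso substructure and embeds bi-Lipschitzly with distortion at most $D$ into $Y$, then $D\ge\alpha\,k^{1/p-1/q}$.
   Context: A map $f:(X,d_X)\to(Y,d_Y)$ is a bi-Lipschitz embedding with distortion at most $D$ if there is $r>0$ with $r\,d_X(x,y)\le d_Y(f(x),f(y))\le rD\,d_X(x,y)$ for all $x,y\in X$. Rounded ball spaces: for $x,y\in Y$ and $\eta>0$ let $\mathrm{Mid}(x,y,\eta)=\{z\in Y:\max\{d_Y(x,z),d_Y(y,z)\}\le\frac{1+\eta}{2}d_Y(x,y)\}$. $(Y,d_Y)$ is a rounded ball space if for every $t>0$ there is $\eta(t)>0$ such that $\mathrm{diam}(\mathrm{Mid}(x,y,\eta(t)))<t\,d_Y(x,y)$ for all distinct $x,y\in Y$. The rounded ball modulus $\eta_Y(t)$ is the supremum of all $\eta(t)>0$ for which this inequality holds for all distinct $x,y\in Y$. $Y$ is a rounded ball space with power type $p$ if there is $c>0$ with $\eta_Y(t)\ge ct^p$ for all $t\in(0,1]$. Laakso graphs: $L_1$ is the graph with vertices $s,a,m_1,m_2,b,t$ and the six edges $\{s,a\},\{a,m_1\},\{a,m_2\},\{m_1,b\},\{m_2,b\},\{b,t\}$.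 Let $L_0$ be a single edge. For $j\ge1$, $L_j$ is obtained from $L_{j-1}$ by replacing every edge $\{u,v\}$ of $L_{j-1}$ by a copy of $L_1$ in which $u,v$ play the roles of $s,t$ (adding four new vertices $a,m_1,m_2,b$ per edge); these copies of $L_1$ are the copies created at level $j$. Thus $V(L_{j-1})\subset V(L_j)$, so the vertices of every copy created at level $j\le k$ are vertices of $L_k$. Thin Laakso substructure: for $\varepsilon>0$, $q\in[1,\infty)$, $k\in\mathbb{N}$, a metric space $(X,d_X)$ admits an $(\varepsilon,q)$-thin $k$-Laakso substructure if there is a collection of points of $X$ indexed by the vertices of $L_k$ (points are identified with their indices) such that for every $1\le j\le k$ and every copy $\{s,a,m_1,m_2,b,t\}$ of $L_1$ created at level $j$: (c1) $d_X(s,a)=d_X(b,t)=\frac12 d_X(a,b)=\frac14 d_X(s,t)>0$; (c2) $d_X(s,b)=d_X(a,t)=\frac34 d_X(s,t)$; (c3) $d_X(m_i,a)=d_X(m_i,b)=\frac14(1+(2\varepsilon)^q)^{1/q}d_X(s,t)$ for $i=1,2$; (c4) $d_X(s,m_i)=d_X(m_i,t)=\frac12(1+\varepsilon^q)^{1/q}d_X(s,t)$ for $i=1,2$; (c5) $d_X(m_1,m_2)=\varepsilon\, d_X(s,t)$. *)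

theory Defs
  imports "HOL-Analysis.Analysis"
begin

definition bilipschitz_embeds :: "'x metric \<Rightarrow> 'y metric \<Rightarrow> real \<Rightarrow> bool" where
  "bilipschitz_embeds X Y D \<longleftrightarrow>
     (\<exists>f \<in> mspace X \<rightarrow> mspace Y. \<exists>r>0. \<forall>x\<in>mspace X. \<forall>y\<in>mspace X.
        r * mdist X x y \<le> mdist Y (f x) (f y) \<and>
        mdist Y (f x) (f y) \<le> r * D * mdist X x y)"

text \<open>The counterpart of \<^const>\<open>diameter\<close> for \<^typ>\<open>'a metric\<close>. It is applied to bounded sets only.\<close>

definition mdiameter :: "'a metric \<Rightarrow> 'a set \<Rightarrow> real" where
  "mdiameter Y S = (if S = {} then 0 else SUP (x,y)\<in>S\<times>S. mdist Y x y)"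

definition Mid :: "'a metric \<Rightarrow> 'a \<Rightarrow> 'a \<Rightarrow> real \<Rightarrow> 'a set" where
  "Mid Y x y \<eta> =
     {z \<in> mspace Y. max (mdist Y x z) (mdist Y y z) \<le> (1 + \<eta>) / 2 * mdist Y x y}"

definition small_midsets :: "'a metric \<Rightarrow> real \<Rightarrow> real \<Rightarrow> bool" where
  "small_midsets Y t \<eta> \<longleftrightarrow>
     (\<forall>x\<in>mspace Y. \<forall>y\<in>mspace Y. x \<noteq> y \<longrightarrow> mdiameter Y (Mid Y x y \<eta>) < t * mdist Y x y)"

definition rounded_ball_space :: "'a metric \<Rightarrow> bool" where
  "rounded_ball_space Y \<longleftrightarrow> (\<forall>t>0. \<exists>\<eta>>0. small_midsets Y t \<eta>)"

text \<open>The supremum is taken in \<^typ>\<open>ereal\<close>: it is infinite if the space has at most one point.\<close>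

definition rounded_ball_modulus :: "'a metric \<Rightarrow> real \<Rightarrow> ereal" where
  "rounded_ball_modulus Y t = (SUP \<eta>\<in>{\<eta>. \<eta> > 0 \<and> small_midsets Y t \<eta>}. ereal \<eta>)"

definition rounded_ball_power_type :: "'a metric \<Rightarrow> real \<Rightarrow> bool" where
  "rounded_ball_power_type Y p \<longleftrightarrow>
     rounded_ball_space Y \<and>
     (\<exists>c>0. \<forall>t\<in>{0<..1}. rounded_ball_modulus Y t \<ge> ereal (c * t powr p))"

text \<open>
  A vertex of a Laakso graph is one of the two ends of the initial edge, or one of the four
  new vertices \<open>a\<close>, \<open>m\<^sub>1\<close>, \<open>m\<^sub>2\<close>, \<open>b\<close> of the copy of \<open>L\<^sub>1\<close> that replaces an edge with ends
  \<open>u\<close>, \<open>v\<close>. Since the constructors record \<open>u\<close> and \<open>v\<close>, new vertices are distinct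
  from the old ones and from those belonging to other edges.
\<close>

datatype laakso_vertex =
    Source
  | Sink
  | VA laakso_vertex laakso_vertex
  | VM1 laakso_vertex laakso_vertex
  | VM2 laakso_vertex laakso_vertex
  | VB laakso_vertex laakso_vertex

text \<open>
  Every undirected edge is listed once, as a pair directed from \<open>Source\<close> towards \<open>Sink\<close>, which
  fixes the roles of its ends as \<open>s\<close> and \<open>t\<close>. The choice of direction is immaterial: reversing
  an edge amounts to exchanging \<open>s\<close> with \<open>t\<close> and \<open>a\<close> with \<open>b\<close> in the copy, which is an
  automorphism of \<open>L\<^sub>1\<close> and leaves the conditions in \<open>thin_laakso_copy\<close> below unchanged.
\<close>

fun laakso_edges :: "nat \<Rightarrow> (laakso_vertex \<times> laakso_vertex) set" where
  "laakso_edges 0 = {(Source, Sink)}"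
| "laakso_edges (Suc j) =
     (\<Union>(u, v)\<in>laakso_edges j.
        {(u, VA u v), (VA u v, VM1 u v), (VA u v, VM2 u v),
         (VM1 u v, VB u v), (VM2 u v, VB u v), (VB u v, v)})"

definition laakso_vertices :: "nat \<Rightarrow> laakso_vertex set" where
  "laakso_vertices k = (\<Union>(u, v)\<in>laakso_edges k. {u, v})"

definition thin_laakso_copy ::
  "'a metric \<Rightarrow> real \<Rightarrow> real \<Rightarrow> 'a \<Rightarrow> 'a \<Rightarrow> 'a \<Rightarrow> 'a \<Rightarrow> 'a \<Rightarrow> 'a \<Rightarrow> bool" where
  "thin_laakso_copy X \<epsilon> q s a m1 m2 b t \<longleftrightarrow>
     (let d = mdist X; L = d s t in
       d s a = L / 4 \<and> d b t = L / 4 \<and> d a b / 2 = L / 4 \<and> L / 4 > 0 \<and>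
       d s b = 3 / 4 * L \<and> d a t = 3 / 4 * L \<and>
       (\<forall>m\<in>{m1, m2}.
          d m a = 1 / 4 * (1 + (2 * \<epsilon>) powr q) powr (1 / q) * L \<and>
          d m b = 1 / 4 * (1 + (2 * \<epsilon>) powr q) powr (1 / q) * L \<and>
          d s m = 1 / 2 * (1 + \<epsilon> powr q) powr (1 / q) * L \<and>
          d m t = 1 / 2 * (1 + \<epsilon> powr q) powr (1 / q) * L) \<and>
       d m1 m2 = \<epsilon> * L)"

text \<open>The copies created at level \<open>j\<close> correspond to the edges of the graph of level \<open>j - 1\<close>.\<close>

definition thin_laakso_substructure :: "'a metric \<Rightarrow> real \<Rightarrow> real \<Rightarrow> nat \<Rightarrow> bool" where
  "thin_laakso_substructure X \<epsilon> q k \<longleftrightarrow>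
     (\<exists>x \<in> laakso_vertices k \<rightarrow> mspace X.
        \<forall>j\<in>{1..k}. \<forall>(s, t)\<in>laakso_edges (j - 1).
          thin_laakso_copy X \<epsilon> q
            (x s) (x (VA s t)) (x (VM1 s t)) (x (VM2 s t)) (x (VB s t)) (x t))"

text \<open>
  A constant that is to serve all metric spaces \<open>X\<close> must not depend on the type of the points
  of \<open>X\<close>, but HOL has no quantification over types below an existential quantifier. The
  conclusion for \<open>X\<close> is therefore named, so that existence of the constants can be stated
  for \<open>X\<close> over the point type of \<open>Y\<close> together with the assertion that any
  such constants also serve all \<open>X\<close> over an arbitrary type.
\<close>

definition laakso_distortion_bound ::
  "real \<Rightarrow> real \<Rightarrow> 'y metric \<Rightarrow> real \<Rightarrow> real \<Rightarrow> real \<Rightarrow> nat \<Rightarrow> 'x metric \<Rightarrow> bool" where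
  "laakso_distortion_bound p q Y \<alpha> D \<epsilon> k X \<longleftrightarrow>
     (thin_laakso_substructure X \<epsilon> q k \<and> bilipschitz_embeds X Y D \<longrightarrow>
      D \<ge> \<alpha> * real k powr (1 / p - 1 / q))"

end

theory Submission
  imports Defs
begin

text \<open>
  Let \<open>M\<close> bound the stretch \<open>d\<^sub>Y(f u, f v) / (r d\<^sub>X(u, v))\<close> of the edges of \<open>L\<^sub>j\<close>. In each copy created at
  level \<open>j\<close>, going from \<open>s\<close> to \<open>m\<^sub>i\<close> along two edges shows that \<open>f m\<^sub>1\<close> and \<open>f m\<^sub>2\<close> are at distance
  at most \<open>(1 + (2\<epsilon>)\<^sup>q) M r d\<^sub>X(s, t) / 2\<close> from \<open>f s\<close> and \<open>f t\<close>. They are at least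
  \<open>\<epsilon> r d\<^sub>X(s, t)\<close> apart, so by roundedness they cannot both be approximate midpoints, and the stretch of
  \<open>{s, t}\<close> is at most \<open>M (1 + (2\<epsilon>)\<^sup>q) / (1 + \<eta>)\<close> with \<open>\<eta>\<close> of order \<open>(\<epsilon>/M)\<^sup>p\<close>. If \<open>\<epsilon>\<^bsup>q-p\<^esup>\<close> is a small
  multiple of \<open>D\<^bsup>-p\<^esup>\<close>, the loss \<open>(2\<epsilon>)\<^sup>q\<close> is absorbed and \<open>M\<^sup>p\<close> drops by a multiple of \<open>\<epsilon>\<^sup>p\<close>.
  Descending from \<open>L\<^sub>k\<close> to \<open>L\<^sub>0\<close> the stretch stays at least 1, so \<open>D\<^sup>p\<close> dominates \<open>k \<epsilon>\<^sup>p\<close>.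
  Measuring the drop of \<open>M\<^sup>p\<close> rather than of \<open>M\<close> is what avoids a logarithmic loss.
\<close>

section \<open>Edges and vertices of Laakso graphs\<close>

lemma laakso_edge_vertices:
  assumes "(u, v) \<in> laakso_edges j"
  shows "u \<in> laakso_vertices j" "v \<in> laakso_vertices j"
  using assms unfolding laakso_vertices_def by blast+

lemma laakso_copy_edges:
  assumes "(s, t) \<in> laakso_edges j"
  shows "(s, VA s t) \<in> laakso_edges (Suc j)" "(VA s t, VM1 s t) \<in> laakso_edges (Suc j)"
    "(VA s t, VM2 s t) \<in> laakso_edges (Suc j)" "(VM1 s t, VB s t) \<in> laakso_edges (Suc j)"
    "(VM2 s t, VB s t) \<in> laakso_edges (Suc j)" "(VB s t, t) \<in> laakso_edges (Suc j)"
  unfolding laakso_edges.simps by (rule UN_I[OF assms], simp)+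

lemma laakso_vertices_mono:
  assumes "j \<le> k"
  shows "laakso_vertices j \<subseteq> laakso_vertices k"
  using assms
proof (induction k rule: dec_induct)
  case (step k)
  have "laakso_vertices k \<subseteq> laakso_vertices (Suc k)"
  proof
    fix w assume "w \<in> laakso_vertices k"
    then obtain u v where "(u, v) \<in> laakso_edges k" "w = u \<or> w = v"
      unfolding laakso_vertices_def by blast
    then show "w \<in> laakso_vertices (Suc k)"
      using laakso_copy_edges(1,6) laakso_edge_vertices by metis
  qed
  then show ?case using step by blast
qed simp

lemma laakso_edges_nonempty: "laakso_edges j \<noteq> {}"
  by (induction j) auto

declare laakso_edges.simps(2) [simp del]

section \<open>Passing to the point type of \<open>Y\<close>\<close>

lemma Metric_space_inv_into:
  assumes "inj_on f (mspace X)"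
  shows "Metric_space (f ` mspace X)
    (\<lambda>u v. mdist X (inv_into (mspace X) f u) (inv_into (mspace X) f v))"
  using assms
  by unfold_locales (auto simp: mdist_commute intro!: mdist_triangle)

text \<open>The lower bound with \<open>r > 0\<close> makes \<open>f\<close> injective, so the
  metric of \<open>X\<close> can be carried to the image of \<open>f\<close>. The resulting
  \<open>Z\<close> is isometric to \<open>X\<close> and inherits its substructure, and the inclusion
  embeds it into \<open>Y\<close> with the same \<open>r\<close> and \<open>D\<close>.\<close>

lemma laakso_distortion_bound_transfer:
  fixes X :: "'x metric" and Y :: "'y metric"
  assumes *: "\<And>Z :: 'y metric. laakso_distortion_bound p q Y \<alpha> D \<epsilon> k Z"
  shows "laakso_distortion_bound p q Y \<alpha> D \<epsilon> k X"
  unfolding laakso_distortion_bound_def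
proof (intro impI, elim conjE)
  assume thin: "thin_laakso_substructure X \<epsilon> q k" and "bilipschitz_embeds X Y D"
  then obtain f r where f: "f \<in> mspace X \<rightarrow> mspace Y" and r: "r > 0"
    and bil: "\<And>x y. x \<in> mspace X \<Longrightarrow> y \<in> mspace X \<Longrightarrow>
        r * mdist X x y \<le> mdist Y (f x) (f y) \<and> mdist Y (f x) (f y) \<le> r * D * mdist X x y"
    unfolding bilipschitz_embeds_def by blast
  have inj: "inj_on f (mspace X)"
  proof (rule inj_onI)
    fix x y assume xy: "x \<in> mspace X" "y \<in> mspace X" "f x = f y"
    then have "mdist Y (f x) (f y) = 0" using f by (subst mdist_zero) auto
    then have "r * mdist X x y \<le> 0" using bil[of x y] xy by simp
    then show "x = y" using r xy mdist_nonneg[of X x y] mdist_zero[of x X y]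
      by (simp add: mult_le_0_iff)
  qed
  define g where "g = inv_into (mspace X) f"
  define Z where "Z = metric (f ` mspace X, \<lambda>u v. mdist X (g u) (g v))"
  interpret M: Metric_space "f ` mspace X" "\<lambda>u v. mdist X (g u) (g v)"
    unfolding g_def by (rule Metric_space_inv_into[OF inj])
  have Z: "mspace Z = f ` mspace X" "mdist Z = (\<lambda>u v. mdist X (g u) (g v))"
    unfolding Z_def by simp_all
  have gf: "g (f x) = x" if "x \<in> mspace X" for x
    using that inj by (simp add: g_def)
  have "bilipschitz_embeds Z Y D"
    unfolding bilipschitz_embeds_def
    by (rule bexI[of _ id], rule exI[of _ r]) (use f r bil in \<open>auto simp: Z gf\<close>)
  moreover have "thin_laakso_substructure Z \<epsilon> q k"
  proof -
    obtain x where x: "x \<in> laakso_vertices k \<rightarrow> mspace X"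
      and c: "\<forall>j\<in>{1..k}. \<forall>(s, t)\<in>laakso_edges (j - 1).
          thin_laakso_copy X \<epsilon> q
            (x s) (x (VA s t)) (x (VM1 s t)) (x (VM2 s t)) (x (VB s t)) (x t)"
      using thin unfolding thin_laakso_substructure_def by blast
    have "thin_laakso_copy Z \<epsilon> q (f (x s)) (f (x (VA s t))) (f (x (VM1 s t))) (f (x (VM2 s t)))
        (f (x (VB s t))) (f (x t))" if j: "j \<in> {1..k}" and st: "(s, t) \<in> laakso_edges (j - 1)" for j s t
    proof -
      \<comment> \<open>Since \<open>j\<close> is at least 1, \<open>Suc (j - 1)\<close> is
        \<open>j\<close>: the vertices of the copy are vertices of level \<open>k\<close>, and
        \<open>g\<close> undoes \<open>f\<close> at their points.\<close>
      have V: "x u \<in> mspace X" "x v \<in> mspace X" if "(u, v) \<in> laakso_edges (Suc (j - 1))" for u v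
        using laakso_edge_vertices[OF that] laakso_vertices_mono[of "Suc (j - 1)" k] j x by auto
      note e = laakso_copy_edges[OF st]
      have "g (f (x v)) = x v" if "v \<in> {s, VA s t, VM1 s t, VM2 s t, VB s t, t}" for v
        using that V[OF e(1)] V[OF e(2)] V[OF e(3)] V[OF e(6)] gf by auto
      moreover have "thin_laakso_copy X \<epsilon> q
          (x s) (x (VA s t)) (x (VM1 s t)) (x (VM2 s t)) (x (VB s t)) (x t)"
        using c j st by blast
      ultimately show ?thesis by (simp add: thin_laakso_copy_def Let_def Z)
    qed
    moreover have "f \<circ> x \<in> laakso_vertices k \<rightarrow> mspace Z" using x by (auto simp: Z)
    ultimately show ?thesis
      unfolding thin_laakso_substructure_def by (intro bexI[of _ "f \<circ> x"]) fastforce+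
  qed
  ultimately show "D \<ge> \<alpha> * real k powr (1 / p - 1 / q)"
    using *[of Z] by (simp add: laakso_distortion_bound_def)
qed

section \<open>Approximate midpoints in rounded ball spaces\<close>

text \<open>The triangle inequality through \<open>x\<close> bounds the midpoint set, so the
  supremum in \<open>mdiameter\<close> is a genuine upper bound.\<close>

lemma mdist_le_mdiameter_Mid:
  assumes "x \<in> mspace Y" "y \<in> mspace Y" and "u \<in> Mid Y x y \<eta>" "v \<in> Mid Y x y \<eta>"
  shows "mdist Y u v \<le> mdiameter Y (Mid Y x y \<eta>)"
proof -
  have "mdist Y a b \<le> (1 + \<eta>) * mdist Y x y"
    if "a \<in> Mid Y x y \<eta>" "b \<in> Mid Y x y \<eta>" for a b
  proof -
    have "mdist Y a b \<le> mdist Y a x + mdist Y x b"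
      using that assms by (intro mdist_triangle) (auto simp: Mid_def)
    also have "\<dots> \<le> (1 + \<eta>) / 2 * mdist Y x y + (1 + \<eta>) / 2 * mdist Y x y"
      using that by (intro add_mono) (auto simp: Mid_def mdist_commute[of Y a x])
    finally show ?thesis by (simp add: field_simps)
  qed
  then have "bdd_above ((\<lambda>(a, b). mdist Y a b) ` (Mid Y x y \<eta> \<times> Mid Y x y \<eta>))"
    by (intro bdd_aboveI[of _ "(1 + \<eta>) * mdist Y x y"]) auto
  then have "mdist Y u v \<le> (SUP (a, b)\<in>Mid Y x y \<eta> \<times> Mid Y x y \<eta>. mdist Y a b)"
    using cSUP_upper[of "(u, v)" "Mid Y x y \<eta> \<times> Mid Y x y \<eta>" "\<lambda>(a, b). mdist Y a b"] assms
    by simp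
  then show ?thesis using assms by (auto simp: mdiameter_def)
qed

lemma rounded_ball_power_typeE:
  assumes "rounded_ball_power_type Y p"
  obtains c where "0 < c" "c \<le> 1"
    "\<And>t. 0 < t \<Longrightarrow> t \<le> 1 \<Longrightarrow> \<exists>\<eta>\<ge>c * t powr p. small_midsets Y t \<eta>"
proof -
  obtain c where c: "c > 0" "\<And>t. t \<in> {0<..1} \<Longrightarrow> rounded_ball_modulus Y t \<ge> ereal (c * t powr p)"
    using assms unfolding rounded_ball_power_type_def by blast
  show ?thesis
  \<comment> \<open>Halving \<open>c\<close> makes the comparison with the modulus strict, so some
    admissible \<eta> exceeds it even if the supremum is not attained. The cap at 1 later gives
    \<open>h \<le> 1\<close>.\<close>
  proof (rule that[of "min 1 (c / 2)"])
    fix t :: real assume t: "0 < t" "t \<le> 1"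
    have "c / 2 * t powr p < c * t powr p" using c t by simp
    then have "ereal (c / 2 * t powr p) < rounded_ball_modulus Y t"
      using c(2)[of t] t by (metis greaterThanAtMost_iff less_ereal.simps(1)
          order_less_le_trans)
    then obtain \<eta> where "small_midsets Y t \<eta>" "c / 2 * t powr p < \<eta>"
      unfolding rounded_ball_modulus_def less_SUP_iff by auto
    moreover have "min 1 (c / 2) * t powr p \<le> c / 2 * t powr p"
      by (intro mult_right_mono) auto
    ultimately show "\<exists>\<eta>\<ge>min 1 (c / 2) * t powr p. small_midsets Y t \<eta>"
      by (intro exI[of _ \<eta>]) auto
  qed (use c in auto)
qed

text \<open>Otherwise \<open>u\<close> and \<open>v\<close> both lie in
  \<open>Mid Y x y \<eta>\<close>, hence are less than \<tau> d(x,y) apart. The path through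
  \<open>u\<close> gives d(x,y) \<le> \<open>B\<close>, contradicting \<open>far\<close>.\<close>

lemma mdist_le_if_separated_midpoints:
  assumes in_Y: "x \<in> mspace Y" "y \<in> mspace Y" "u \<in> mspace Y" "v \<in> mspace Y"
    and close: "\<And>w. w \<in> {u, v} \<Longrightarrow> mdist Y x w \<le> B / 2 \<and> mdist Y w y \<le> B / 2"
    and far: "\<tau> * B \<le> mdist Y u v" "0 < \<tau>"
    and pos: "mdist Y x y > 0"
    and mid: "small_midsets Y \<tau> \<eta>"
  shows "(1 + \<eta>) * mdist Y x y \<le> B"
proof (rule ccontr)
  assume "\<not> (1 + \<eta>) * mdist Y x y \<le> B"
  then have B: "B / 2 \<le> (1 + \<eta>) / 2 * mdist Y x y" by simp
  have "u \<in> Mid Y x y \<eta>" "v \<in> Mid Y x y \<eta>"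
    using close[of u] close[of v] in_Y B by (auto simp: Mid_def mdist_commute[of Y y])
  then have "mdist Y u v \<le> mdiameter Y (Mid Y x y \<eta>)"
    using in_Y by (intro mdist_le_mdiameter_Mid)
  moreover have "x \<noteq> y" using pos in_Y(1) by (metis less_irrefl mdist_zero)
  then have "mdiameter Y (Mid Y x y \<eta>) < \<tau> * mdist Y x y"
    using mid in_Y unfolding small_midsets_def by blast
  moreover have "mdist Y x y \<le> mdist Y x u + mdist Y u y"
    using in_Y by (intro mdist_triangle)
  then have "\<tau> * mdist Y x y \<le> \<tau> * B"
    using close[of u] far by simp
  ultimately show False using far by simp
qed

section \<open>Descent of the stretch through the levels\<close>

text \<open>The condition \<open>eps_small\<close> is stated with \<open>D\<close>, the largest
  stretch that has to be considered, so that one \<epsilon> serves every level.\<close>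

locale laakso_embedding =
  fixes X :: "'x metric" and Y :: "'y metric" and x :: "laakso_vertex \<Rightarrow> 'x" and f :: "'x \<Rightarrow> 'y"
    and \<epsilon> q r c p D :: real and k :: nat
  assumes p: "1 < p" "p < q"
    and c: "0 < c" "c \<le> 1"
    and modulus: "\<And>t. 0 < t \<Longrightarrow> t \<le> 1 \<Longrightarrow> \<exists>\<eta>\<ge>c * t powr p. small_midsets Y t \<eta>"
    and x: "x \<in> laakso_vertices k \<rightarrow> mspace X"
    and thin: "\<And>j s t. j < k \<Longrightarrow> (s, t) \<in> laakso_edges j \<Longrightarrow> thin_laakso_copy X \<epsilon> q
            (x s) (x (VA s t)) (x (VM1 s t)) (x (VM2 s t)) (x (VB s t)) (x t)"
    and f: "f \<in> mspace X \<rightarrow> mspace Y"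
    and r: "0 < r"
    and lower: "\<And>u v. u \<in> mspace X \<Longrightarrow> v \<in> mspace X \<Longrightarrow> r * mdist X u v \<le> mdist Y (f u) (f v)"
    and upper: "\<And>u v. u \<in> mspace X \<Longrightarrow> v \<in> mspace X \<Longrightarrow> mdist Y (f u) (f v) \<le> r * D * mdist X u v"
    and D: "1 \<le> D"
    and eps: "0 < \<epsilon>" "\<epsilon> \<le> 1"
    and eps_small: "(2 * \<epsilon>) powr q \<le> c / 4 * (\<epsilon> / (4 * D)) powr p"
begin

definition stretch_le :: "nat \<Rightarrow> real \<Rightarrow> bool" where
  "stretch_le j M \<longleftrightarrow>
     (\<forall>(u, v)\<in>laakso_edges j. mdist Y (f (x u)) (f (x v)) \<le> M * (r * mdist X (x u) (x v)))"

lemma in_mspace: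
  assumes "(u, v) \<in> laakso_edges j" "j \<le> k"
  shows "x u \<in> mspace X" "x v \<in> mspace X" "f (x u) \<in> mspace Y" "f (x v) \<in> mspace Y"
  using laakso_edge_vertices[OF assms(1)] laakso_vertices_mono[OF assms(2)] x f
  by (auto simp: Pi_iff)

lemma stretch_le_D: "stretch_le k D"
proof -
  have "mdist Y (f (x u)) (f (x v)) \<le> D * (r * mdist X (x u) (x v))"
    if "(u, v) \<in> laakso_edges k" for u v
    using upper[of "x u" "x v"] in_mspace[OF that] by (simp add: mult_ac)
  then show ?thesis unfolding stretch_le_def by blast
qed

text \<open>An edge below level \<open>k\<close> is replaced by a copy, whose condition (c1) makes
  its length positive; the lower bound of the embedding can then be divided by that length.\<close>

lemma stretch_ge_1:
  assumes "stretch_le j M" "j < k"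
  shows "1 \<le> M"
proof -
  obtain s t where st: "(s, t) \<in> laakso_edges j" using laakso_edges_nonempty[of j] by auto
  have pos: "0 < mdist X (x s) (x t)"
    using thin[OF assms(2) st] by (simp add: thin_laakso_copy_def Let_def)
  have "r * mdist X (x s) (x t) \<le> M * (r * mdist X (x s) (x t))"
    using lower[of "x s" "x t"] in_mspace[OF st] assms st by (fastforce simp: stretch_le_def)
  then show ?thesis using pos r by simp
qed

text \<open>The parameter \<open>\<epsilon> / (4 M)\<close> leaves room for the factor \<open>1 + (2\<epsilon>)\<^sup>q \<le> 2\<close>.\<close>

lemma stretch_descend:
  assumes M: "stretch_le (Suc j) M" "1 \<le> M" "M \<le> D" and j: "j < k"
  shows "stretch_le j (M * (1 - c / 4 * (\<epsilon> / (4 * M)) powr p))"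
  unfolding stretch_le_def
proof (clarify)
  fix s t assume st: "(s, t) \<in> laakso_edges j"
  define \<tau> where "\<tau> = \<epsilon> / (4 * M)"
  define h where "h = c * \<tau> powr p"
  define L where "L = r * mdist X (x s) (x t)"
  define \<delta> where "\<delta> = (2 * \<epsilon>) powr q"
  note cp = thin[OF j st, unfolded thin_laakso_copy_def Let_def]
  note e = laakso_copy_edges[OF st]
  note e_in = in_mspace[OF e(1)] in_mspace[OF e(2)] in_mspace[OF e(3)] in_mspace[OF e(6)]
  have stretch: "mdist Y (f (x u)) (f (x v)) \<le> M * (r * mdist X (x u) (x v))"
    if "(u, v) \<in> laakso_edges (Suc j)" for u v
    using M that by (auto simp: stretch_le_def)
  have L: "0 < L" using cp r by (simp add: L_def)
  have \<tau>: "0 < \<tau>" "\<tau> \<le> 1" using eps M by (auto simp: \<tau>_def divide_simps)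
  have "\<tau> powr p \<le> 1" using \<tau> p powr_le1[of p \<tau>] by simp
  then have h: "0 < h" "h \<le> 1" using c \<tau> mult_le_one[of c "\<tau> powr p"] by (auto simp: h_def)
  have "(\<epsilon> / (4 * D)) powr p \<le> \<tau> powr p"
    unfolding \<tau>_def using M D eps p by (intro powr_mono2 divide_left_mono) auto
  then have \<delta>: "0 \<le> \<delta>" "\<delta> \<le> h / 4"
    using eps_small c mult_left_mono[of "(\<epsilon> / (4 * D)) powr p" "\<tau> powr p" "c / 4"]
    unfolding \<delta>_def h_def by (simp, linarith)
  \<comment> \<open>Dropping the root is harmless: only a loss linear in \<delta> has to be
    absorbed.\<close>
  have "(1 + \<delta>) powr (1 / q) \<le> (1 + \<delta>) powr 1"
    using \<delta> p by (intro powr_mono) auto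
  then have root: "1 + (1 + \<delta>) powr (1 / q) \<le> 2 * (1 + \<delta>)"
    using \<delta> by simp
  obtain \<eta> where \<eta>: "h \<le> \<eta>" "small_midsets Y \<tau> \<eta>"
    using modulus \<tau> unfolding h_def by blast
  \<comment> \<open>Half of \<open>B\<close> dominates the two-edge path from either end to a middle
    vertex.\<close>
  define B where "B = M * L * (1 + \<delta>)"
  have path: "M * (r * (1 / 4 * mdist X (x s) (x t))) +
      M * (r * (1 / 4 * (1 + \<delta>) powr (1 / q) * mdist X (x s) (x t))) \<le> B / 2"
  proof -
    have "M * L / 4 * (1 + (1 + \<delta>) powr (1 / q)) \<le> M * L / 4 * (2 * (1 + \<delta>))"
      using root M L by (intro mult_left_mono) auto
    then show ?thesis by (simp add: B_def L_def algebra_simps)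
  qed
  have close: "mdist Y (f (x s)) w \<le> B / 2 \<and> mdist Y w (f (x t)) \<le> B / 2"
    if w: "w \<in> {f (x (VM1 s t)), f (x (VM2 s t))}" for w
  proof -
    obtain m where m: "m \<in> {VM1 s t, VM2 s t}" "w = f (x m)" using w by auto
    then have em: "(VA s t, m) \<in> laakso_edges (Suc j)" "(m, VB s t) \<in> laakso_edges (Suc j)"
      using e by auto
    have dm: "mdist X (x (VA s t)) (x m) = 1 / 4 * (1 + \<delta>) powr (1 / q) * mdist X (x s) (x t)"
      "mdist X (x m) (x (VB s t)) = 1 / 4 * (1 + \<delta>) powr (1 / q) * mdist X (x s) (x t)"
      using cp m unfolding \<delta>_def by (auto simp: mdist_commute[of X "x (VA s t)"])
    have ds: "mdist X (x s) (x (VA s t)) = 1 / 4 * mdist X (x s) (x t)"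
      "mdist X (x (VB s t)) (x t) = 1 / 4 * mdist X (x s) (x t)"
      using cp by simp_all
    have "mdist Y (f (x s)) w \<le>
        mdist Y (f (x s)) (f (x (VA s t))) + mdist Y (f (x (VA s t))) w"
      unfolding m using in_mspace[OF em(1)] e_in j by (intro mdist_triangle) auto
    also have "\<dots> \<le> B / 2"
      using stretch[OF e(1)] stretch[OF em(1)] path unfolding ds dm m(2) by linarith
    finally have 1: "mdist Y (f (x s)) w \<le> B / 2" .
    have "mdist Y w (f (x t)) \<le>
        mdist Y w (f (x (VB s t))) + mdist Y (f (x (VB s t))) (f (x t))"
      unfolding m using in_mspace[OF em(2)] e_in j by (intro mdist_triangle) auto
    also have "\<dots> \<le> B / 2"
      using stretch[OF e(6)] stretch[OF em(2)] path unfolding ds dm m(2) by linarith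
    finally show ?thesis using 1 by blast
  qed
  have "\<tau> * B = \<epsilon> * L * ((1 + \<delta>) / 4)"
    using M by (simp add: \<tau>_def B_def)
  also have "\<dots> \<le> \<epsilon> * L * 1"
    using \<delta> h eps L by (intro mult_left_mono) auto
  also have "\<epsilon> * L * 1 = r * mdist X (x (VM1 s t)) (x (VM2 s t))"
    using cp by (simp add: L_def)
  also have "\<dots> \<le> mdist Y (f (x (VM1 s t))) (f (x (VM2 s t)))"
    using lower e_in j by simp
  finally have far: "\<tau> * B \<le> mdist Y (f (x (VM1 s t))) (f (x (VM2 s t)))" .
  have pos: "0 < mdist Y (f (x s)) (f (x t))"
    using L lower[of "x s" "x t"] e_in j by (simp add: L_def)
  have "(1 + \<eta>) * mdist Y (f (x s)) (f (x t)) \<le> B"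
    using mdist_le_if_separated_midpoints[OF _ _ _ _ close far \<tau>(1) pos \<eta>(2)] e_in j by simp
  moreover have "(1 + h) * mdist Y (f (x s)) (f (x t)) \<le> (1 + \<eta>) * mdist Y (f (x s)) (f (x t))"
    using \<eta> pos by (intro mult_right_mono) auto
  \<comment> \<open>This turns division by 1 + h into the factor 1 - h/4; for h \<le> 1 the product
    is at least 1 + h/4, which covers 1 + \<delta>.\<close>
  moreover have "B \<le> M * L * ((1 + h) * (1 - h / 4))"
  proof -
    have "(1 + h) * (1 - h / 4) = 1 + h / 4 + h / 4 * (2 - h)" by (simp add: field_simps)
    moreover have "0 \<le> h / 4 * (2 - h)" using h by simp
    ultimately have "1 + \<delta> \<le> (1 + h) * (1 - h / 4)" using \<delta> by linarith
    then show ?thesis unfolding B_def using M L by (intro mult_left_mono) auto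
  qed
  ultimately have "(1 + h) * mdist Y (f (x s)) (f (x t)) \<le> (1 + h) * (M * (1 - h / 4) * L)"
    by (simp add: mult_ac)
  then have "mdist Y (f (x s)) (f (x t)) \<le> M * (1 - h / 4) * L"
    using h by simp
  then show "mdist Y (f (x s)) (f (x t))
      \<le> M * (1 - c / 4 * (\<epsilon> / (4 * M)) powr p) * (r * mdist X (x s) (x t))"
    by (simp add: h_def \<tau>_def L_def)
qed

text \<open>Each descent replaces M by M (1 - h) with h proportional to M^(-p). As (1 - h)^p \<le> 1
  - h, the power M^p loses at least M^p h, an amount independent of M.\<close>

lemma stretch_bound:
  assumes "i \<le> k"
  shows "\<exists>M\<ge>1. stretch_le (k - i) M \<and> M powr p + real i * (c / 4 * (\<epsilon> / 4) powr p) \<le> D powr p"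
  using assms
proof (induction i)
  case 0
  then show ?case using stretch_le_D D by auto
next
  case (Suc i)
  then obtain M where M: "1 \<le> M" "stretch_le (Suc (k - Suc i)) M"
    "M powr p + real i * (c / 4 * (\<epsilon> / 4) powr p) \<le> D powr p"
    by (metis Suc_diff_Suc Suc_leD Suc_le_lessD)
  \<comment> \<open>The invariant itself supplies \<open>M \<le> D\<close>, needed for the next
    descent.\<close>
  have "M powr p \<le> D powr p" using M(3) c by (smt (verit) divide_nonneg_pos mult_nonneg_nonneg of_nat_0_le_iff powr_ge_zero)
  then have MD: "M \<le> D" using D p powr_less_mono2[of p D M] by fastforce
  define h where "h = c / 4 * (\<epsilon> / (4 * M)) powr p"
  have "(\<epsilon> / (4 * M)) powr p \<le> 1"
    using M p eps by (intro powr_le1) (auto simp: divide_simps)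
  then have h: "0 \<le> h" "h \<le> 1"
    using c mult_mono[of "c / 4" 1 "(\<epsilon> / (4 * M)) powr p" 1] by (auto simp: h_def)
  have st: "stretch_le (k - Suc i) (M * (1 - h))"
    using stretch_descend[OF M(2) M(1) MD] Suc.prems by (simp add: h_def)
  have ge: "1 \<le> M * (1 - h)" using stretch_ge_1[OF st] Suc.prems by simp
  have "(M * (1 - h)) powr p = M powr p * (1 - h) powr p"
    using M h by (simp add: powr_mult)
  also have "\<dots> \<le> M powr p * (1 - h)"
    using h p powr_mono'[of 1 p "1 - h"] by (intro mult_left_mono) auto
  also have "\<dots> = M powr p - c / 4 * (\<epsilon> / 4) powr p"
    using M eps by (simp add: h_def algebra_simps powr_divide powr_mult)
  finally show ?case using M(3) st ge
    by (intro exI[of _ "M * (1 - h)"]) (auto simp: algebra_simps add_divide_distrib)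
qed

lemma distortion_bound: "real k * (c / 4 * (\<epsilon> / 4) powr p) \<le> D powr p"
proof -
  obtain M where "M powr p + real k * (c / 4 * (\<epsilon> / 4) powr p) \<le> D powr p"
    using stretch_bound[of k] by blast
  then show ?thesis using powr_ge_zero[of M p] by linarith
qed

end

section \<open>Choice of the constants\<close>

text \<open>Take \<epsilon> with equality in \<open>eps_small\<close>, that is \<epsilon>^(q-p) = b
  / D^p. Substituted into \<open>distortion_bound\<close>, this gives k \<beta> \<le> D^(p +
  p^2/(q-p)), whose exponent is 1/\<theta>; hence \<alpha> = \<beta>^\<theta>.\<close>

lemma laakso_distortion_bound_exists:
  fixes p q :: real and Y :: "'y metric"
  assumes p: "1 < p" "p < q" and Y: "rounded_ball_power_type Y p"
  shows "\<exists>\<alpha>>0. \<forall>D\<ge>1. \<exists>\<epsilon>>0. \<forall>k. \<forall>X :: 'x metric. laakso_distortion_bound p q Y \<alpha> D \<epsilon> k X"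
proof -
  obtain c where c: "0 < c" "c \<le> 1"
    "\<And>t. 0 < t \<Longrightarrow> t \<le> 1 \<Longrightarrow> \<exists>\<eta>\<ge>c * t powr p. small_midsets Y t \<eta>"
    using rounded_ball_power_typeE[OF Y] by blast
  define b where "b = c / (4 * 4 powr p * 2 powr q)"
  define \<beta> where "\<beta> = c / (4 * 4 powr p) * b powr (p / (q - p))"
  define \<theta> where "\<theta> = 1 / p - 1 / q"
  have b: "0 < b" "b \<le> 1"
  proof -
    show "0 < b" using c by (simp add: b_def)
    have "1 \<le> (4::real) powr p" "1 \<le> (2::real) powr q" using p by (auto intro!: ge_one_powr_ge_zero)
    then have "1 \<le> 4 powr p * (2::real) powr q" using mult_mono[of 1 "(4::real) powr p" 1 "2 powr q"] by simp
    then show "b \<le> 1" using c by (simp add: b_def divide_simps)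
  qed
  have \<beta>: "0 < \<beta>" using b c by (simp add: \<beta>_def)
  have \<theta>: "0 < \<theta>" "\<theta> = (q - p) / (p * q)" using p by (auto simp: \<theta>_def field_simps)
  have bound: "laakso_distortion_bound p q Y (\<beta> powr \<theta>) D ((b / D powr p) powr (1 / (q - p))) k X"
    if D: "1 \<le> D" for D k and X :: "'x metric"
    unfolding laakso_distortion_bound_def
  proof (intro impI, elim conjE)
    define \<epsilon> where "\<epsilon> = (b / D powr p) powr (1 / (q - p))"
    assume thin: "thin_laakso_substructure X ((b / D powr p) powr (1 / (q - p))) q k"
      and emb: "bilipschitz_embeds X Y D"
    obtain x where x: "x \<in> laakso_vertices k \<rightarrow> mspace X"
      and copies: "\<forall>j\<in>{1..k}. \<forall>(s, t)\<in>laakso_edges (j - 1). thin_laakso_copy X \<epsilon> q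
          (x s) (x (VA s t)) (x (VM1 s t)) (x (VM2 s t)) (x (VB s t)) (x t)"
      using thin unfolding thin_laakso_substructure_def \<epsilon>_def by blast
    obtain f r where f: "f \<in> mspace X \<rightarrow> mspace Y" "r > 0"
      "\<forall>x\<in>mspace X. \<forall>y\<in>mspace X. r * mdist X x y \<le> mdist Y (f x) (f y) \<and>
        mdist Y (f x) (f y) \<le> r * D * mdist X x y"
      using emb unfolding bilipschitz_embeds_def by blast
    have Dp: "1 \<le> D powr p" using D p by (intro ge_one_powr_ge_zero) auto
    have eps: "0 < \<epsilon>" "\<epsilon> \<le> 1"
      using b D Dp p unfolding \<epsilon>_def by (auto intro!: powr_le1 simp: divide_simps)
    have "\<epsilon> powr (q - p) = b / D powr p"
      using b Dp p by (simp add: \<epsilon>_def powr_powr)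
    then have "\<epsilon> powr q = b / D powr p * \<epsilon> powr p"
      using eps powr_add[of \<epsilon> "q - p" p] by simp
    then have eps_small: "(2 * \<epsilon>) powr q = c / 4 * (\<epsilon> / (4 * D)) powr p"
      using eps D by (simp add: powr_mult powr_divide b_def)
    interpret laakso_embedding X Y x f \<epsilon> q r c p D k
    proof
      show "thin_laakso_copy X \<epsilon> q
            (x s) (x (VA s t)) (x (VM1 s t)) (x (VM2 s t)) (x (VB s t)) (x t)"
        if "j < k" "(s, t) \<in> laakso_edges j" for j s t
        using bspec[OF copies, of "Suc j"] that by auto
      show "(2 * \<epsilon>) powr q \<le> c / 4 * (\<epsilon> / (4 * D)) powr p" using eps_small by simp
      show "r * mdist X u v \<le> mdist Y (f u) (f v)" "mdist Y (f u) (f v) \<le> r * D * mdist X u v"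
        if "u \<in> mspace X" "v \<in> mspace X" for u v
        using f(3) that by blast+
    qed (fact p c x f(1,2) D eps)+
    have "\<epsilon> powr p = b powr (p / (q - p)) / D powr (p * p / (q - p))"
      using b D by (simp add: \<epsilon>_def powr_powr powr_divide)
    then have "real k * \<beta> / D powr (p * p / (q - p)) \<le> D powr p"
      using distortion_bound eps by (simp add: \<beta>_def powr_divide mult_ac)
    then have "real k * \<beta> \<le> D powr p * D powr (p * p / (q - p))"
      using D by (simp add: divide_simps)
    also have "\<dots> = D powr (1 / \<theta>)"
    proof -
      have "p + p * p / (q - p) = 1 / \<theta>" using p by (simp add: \<theta> field_simps)
      then show ?thesis by (simp flip: powr_add)
    qed
    finally have "(real k * \<beta>) powr \<theta> \<le> (D powr (1 / \<theta>)) powr \<theta>"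
      using \<beta> \<theta>(1) by (intro powr_mono2) auto
    then show "\<beta> powr \<theta> * real k powr (1 / p - 1 / q) \<le> D"
      using \<theta>(1) D \<beta> by (simp add: powr_powr powr_mult \<theta>_def[symmetric] mult.commute)
  qed
  show ?thesis
  proof (rule exI[of _ "\<beta> powr \<theta>"], intro conjI allI impI)
    show "0 < \<beta> powr \<theta>" using \<beta> by simp
    fix D :: real assume D: "1 \<le> D"
    show "\<exists>\<epsilon>>0. \<forall>k. \<forall>X :: 'x metric. laakso_distortion_bound p q Y (\<beta> powr \<theta>) D \<epsilon> k X"
      by (rule exI[of _ "(b / D powr p) powr (1 / (q - p))"]) (use b D bound[OF D] in simp)
  qed
qed

theorem theorem5:
  fixes p q :: real and Y :: "'y metric"
  assumes "1 < p" and "p < q"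
    and "rounded_ball_power_type Y p"
  shows "(\<exists>\<alpha>>0. \<forall>D\<ge>1. \<exists>\<epsilon>>0. \<forall>k. \<forall>X :: 'y metric. laakso_distortion_bound p q Y \<alpha> D \<epsilon> k X) \<and>
    (\<forall>\<alpha>>0. \<forall>D\<ge>1. \<forall>\<epsilon>>0.
      (\<forall>k. \<forall>X :: 'y metric. laakso_distortion_bound p q Y \<alpha> D \<epsilon> k X) \<longrightarrow>
      (\<forall>k. \<forall>X :: 'x metric. laakso_distortion_bound p q Y \<alpha> D \<epsilon> k X))"
proof (intro conjI allI impI)
  show "\<exists>\<alpha>>0. \<forall>D\<ge>1. \<exists>\<epsilon>>0. \<forall>k. \<forall>X :: 'y metric. laakso_distortion_bound p q Y \<alpha> D \<epsilon> k X"
    by (rule laakso_distortion_bound_exists[OF assms])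
  fix \<alpha> D \<epsilon> k and X :: "'x metric"
  \<comment> \<open>These constants are arbitrary, not those constructed above, so only the transfer
    applies.\<close>
  assume "\<forall>k. \<forall>X :: 'y metric. laakso_distortion_bound p q Y \<alpha> D \<epsilon> k X"
  then have "laakso_distortion_bound p q Y \<alpha> D \<epsilon> k Z" for Z :: "'y metric" by blast
  then show "laakso_distortion_bound p q Y \<alpha> D \<epsilon> k X"
    by (rule laakso_distortion_bound_transfer)
qed

end
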